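(* For every finite connected graph $G$, $c_b(G)\le \gamma_2(G)+1$.
   Context: Bridge-burning Cops and Robbers is played on a finite graph $G$ by a team of cops and a single robber, with full information. First each cop chooses a starting vertex (several cops may share a vertex), then the robber chooses a starting vertex. The game then proceeds in rounds; in each round, first every cop either stays put or moves along an edge of the current graph to an adjacent vertex, and then the robber either stays put or moves along an edge of the current graph. Every edge traversed by the robber is immediately deleted from the graph (cop moves delete nothing). The cops win if at some moment some cop occupies the same vertex as the robber; the robber wins if he avoids this forever. $c_b(G)$ is the minimum number of cops for which the cops have a winning strategy. A distance-2 dominating set of $G$ is a set $S\subseteq V(G)$ such that every vertex of $G$ is at distance at most 2 from some member of $S$; $\gamma_2(G)$ is the minimum size of a distance-2 dominating set. *)

theory Defs
  imports "Graph_Theory.Graph_Theory"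
begin

section \<open>Distance-2 domination\<close>

text \<open>
  A finite simple graph is a \<open>pair_graph\<close>: each undirected edge is represented by its two
  opposite arcs. The graph distance is the library's shortest-path cost for unit weights;
  it is infinite for vertices that are not joined by a walk.
\<close>

definition graph_dist :: "'a pair_pre_digraph \<Rightarrow> 'a \<Rightarrow> 'a \<Rightarrow> ereal" where
  "graph_dist G u v = wf_digraph.\<mu> (with_proj G) (\<lambda>_. 1) u v"

definition dist2_dominating :: "'a pair_pre_digraph \<Rightarrow> 'a set \<Rightarrow> bool" where
  "dist2_dominating G S \<longleftrightarrow>
     S \<subseteq> pverts G \<and> (\<forall>v \<in> pverts G. \<exists>s \<in> S. graph_dist G s v \<le> 2)"

definition dist2_domination_number :: "'a pair_pre_digraph \<Rightarrow> nat" where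
  "dist2_domination_number G = (LEAST n. \<exists>S. dist2_dominating G S \<and> card S = n)"

section \<open>Bridge-burning Cops and Robbers\<close>

text \<open>
  A play is described by the robber's positions \<open>r 0, r 1, \<dots>\<close>, where \<open>r n\<close> is his position
  after \<open>n\<close> rounds. The cops are numbered \<open>0, \<dots>, k - 1\<close>. A strategy maps the list of robber
  positions seen so far to the next positions of the cops: the value at the empty list is the
  initial placement (made before the robber chooses his start), and the value at
  \<open>[r 0, \<dots>, r n]\<close> is the position to which the cops move in round \<open>n + 1\<close>. Because the cops'
  own past positions and the deleted edges are determined by the strategy and the robber's
  positions, this list carries full information about the play.
\<close>

type_synonym 'a cop_strategy = "'a list \<Rightarrow> nat \<Rightarrow> 'a"

definition cop_position :: "'a cop_strategy \<Rightarrow> (nat \<Rightarrow> 'a) \<Rightarrow> nat \<Rightarrow> nat \<Rightarrow> 'a" where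
  "cop_position \<sigma> r n i = \<sigma> (map r [0..<n]) i"

text \<open>The graph after \<open>n\<close> rounds. If the robber stays put in a round, only the
  loop-shaped pair is subtracted, which is not an arc of a simple graph.\<close>

definition graph_after :: "'a pair_pre_digraph \<Rightarrow> (nat \<Rightarrow> 'a) \<Rightarrow> nat \<Rightarrow> 'a pair_pre_digraph" where
  "graph_after G r n =
     G\<lparr>parcs := parcs G - (\<Union>m<n. {(r m, r (Suc m)), (r (Suc m), r m)})\<rparr>"

definition legal_move :: "'a pair_pre_digraph \<Rightarrow> 'a \<Rightarrow> 'a \<Rightarrow> bool" where
  "legal_move H u v \<longleftrightarrow> v = u \<or> (u, v) \<in> parcs H"

definition legal_robber :: "'a pair_pre_digraph \<Rightarrow> (nat \<Rightarrow> 'a) \<Rightarrow> bool" where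
  "legal_robber G r \<longleftrightarrow>
     r 0 \<in> pverts G \<and> (\<forall>n. legal_move (graph_after G r n) (r n) (r (Suc n)))"

definition legal_cops ::
  "'a pair_pre_digraph \<Rightarrow> nat \<Rightarrow> 'a cop_strategy \<Rightarrow> (nat \<Rightarrow> 'a) \<Rightarrow> bool" where
  "legal_cops G k \<sigma> r \<longleftrightarrow>
     (\<forall>i<k. cop_position \<sigma> r 0 i \<in> pverts G \<and>
        (\<forall>n. legal_move (graph_after G r n) (cop_position \<sigma> r n i) (cop_position \<sigma> r (Suc n) i)))"

text \<open>The first disjunct is a meeting after the initial placement or after a move of the robber,
  the second one a meeting after the cops' move in round \<open>n + 1\<close>.\<close>

definition captured :: "nat \<Rightarrow> 'a cop_strategy \<Rightarrow> (nat \<Rightarrow> 'a) \<Rightarrow> bool" where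
  "captured k \<sigma> r \<longleftrightarrow>
     (\<exists>n. \<exists>i<k. cop_position \<sigma> r n i = r n \<or> cop_position \<sigma> r (Suc n) i = r n)"

text \<open>Plays are formally continued forever after a capture. This changes nothing, since
  staying put is always legal for both sides and a capture is never revoked.\<close>

definition winning_strategy :: "'a pair_pre_digraph \<Rightarrow> nat \<Rightarrow> 'a cop_strategy \<Rightarrow> bool" where
  "winning_strategy G k \<sigma> \<longleftrightarrow>
     (\<forall>r. legal_robber G r \<longrightarrow> legal_cops G k \<sigma> r \<and> captured k \<sigma> r)"

definition bridge_burning_cop_number :: "'a pair_pre_digraph \<Rightarrow> nat" where
  "bridge_burning_cop_number G = (LEAST k. \<exists>\<sigma>. winning_strategy G k \<sigma>)"

section \<open>Both minima are attained\<close>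

lemma dist2_dominating_pverts:
  assumes "pair_graph G"
  shows "dist2_dominating G (pverts G)"
proof -
  interpret pair_graph G by fact
  have "graph_dist G v v \<le> 2" if "v \<in> pverts G" for v
  proof -
    have "awalk v [] v" using that by (simp add: awalk_Nil_iff)
    then have "graph_dist G v v \<le> awalk_cost (\<lambda>_. 1) []"
      unfolding graph_dist_def by (rule min_cost_le_walk_cost)
    then show ?thesis by (simp add: zero_ereal_def[symmetric] order_trans[of _ 0])
  qed
  then show ?thesis unfolding dist2_dominating_def by blast
qed

lemma winning_strategy_card_pverts:
  assumes "pair_graph G"
  shows "\<exists>\<sigma>. winning_strategy G (card (pverts G)) \<sigma>"
proof -
  interpret pair_graph G by fact
  obtain f where f: "bij_betw f {0..<card (pverts G)} (pverts G)"
    using ex_bij_betw_nat_finite[OF pair_finite_verts] by blast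
  have "winning_strategy G (card (pverts G)) (\<lambda>_. f)"
    unfolding winning_strategy_def
  proof (intro allI impI conjI)
    fix r assume r: "legal_robber G r"
    show "legal_cops G (card (pverts G)) (\<lambda>_. f) r"
      using f by (auto simp: legal_cops_def cop_position_def legal_move_def bij_betw_def)
    from r have "r 0 \<in> f ` {0..<card (pverts G)}"
      using f by (simp add: legal_robber_def bij_betw_def)
    then obtain i where "i < card (pverts G)" "f i = r 0"
      by auto
    then show "captured (card (pverts G)) (\<lambda>_. f) r"
      unfolding captured_def cop_position_def by blast
  qed
  then show ?thesis by blast
qed

end

theory Submission
  imports Defs
begin

text \<open>
  Put a guard on every vertex of a distance-2 dominating set \<open>S\<close> and one further cop, the chaser,
  anywhere. The guards keep the robber on the vertices at distance exactly 2 from \<open>S\<close>, so only edges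
  between such vertices are ever burned. Whenever the robber stands next to a bridge \<open>uv\<close> of the
  current graph, a guard \<open>s\<close> with a path \<open>s - x - v\<close> lies behind that bridge; he steps to \<open>x\<close> and
  stays there, so that crossing the bridge is fatal. What \<open>s\<close> leaves unguarded lies behind the
  bridge too. Hence the robber burns non-bridges only, the graph stays connected, he makes
  finitely many moves, and the chaser reaches him.
\<close>

section \<open>Strategies in which every cop plays for himself\<close>

text \<open>The robber's positions are listed backwards, latest first.\<close>

primrec memoryless_position ::
  "('a rel \<Rightarrow> 'a \<Rightarrow> 'a \<Rightarrow> 'a) \<Rightarrow> 'a \<Rightarrow> 'a rel \<Rightarrow> 'a list \<Rightarrow> 'a" where
  "memoryless_position mv s A [] = s"
| "memoryless_position mv s A (u # us) =
     mv (A - set (zip us (u # us)) - set (zip (u # us) us)) u (memoryless_position mv s A us)"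

text \<open>Zipping a history with its extension by one position truncates to n pairs: the n steps
  made so far, in either orientation.\<close>

lemma set_zip_history:
  "set (zip (rev (map r [0..<n])) (rev (map r [0..<Suc n]))) = (\<Union>m<n. {(r m, r (Suc m))})"
  "set (zip (rev (map r [0..<Suc n])) (rev (map r [0..<n]))) = (\<Union>m<n. {(r (Suc m), r m)})"
  by (induction n) (simp_all add: lessThan_Suc)

text \<open>Turns rules that read only the current graph, the robber's vertex and the cop's own
  vertex into a strategy on histories, so that the rest of the proof works with a recursion over
  rounds.\<close>

lemma memoryless_strategy:
  fixes mv :: "nat \<Rightarrow> 'a rel \<Rightarrow> 'a \<Rightarrow> 'a \<Rightarrow> 'a"
  obtains \<sigma> where
    "\<And>r i. cop_position \<sigma> r 0 i = start i"
    "\<And>r n i. cop_position \<sigma> r (Suc n) i =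
       mv i (parcs (graph_after G r n)) (r n) (cop_position \<sigma> r n i)"
proof
  let ?\<sigma> = "\<lambda>us i. memoryless_position (mv i) (start i) (parcs G) (rev us)"
  show "cop_position ?\<sigma> r 0 i = start i" for r i
    by (simp add: cop_position_def)
  show "cop_position ?\<sigma> r (Suc n) i =
      mv i (parcs (graph_after G r n)) (r n) (cop_position ?\<sigma> r n i)" for r n i
  proof -
    have "parcs (graph_after G r n) =
        parcs G - set (zip (rev (map r [0..<n])) (rev (map r [0..<Suc n])))
          - set (zip (rev (map r [0..<Suc n])) (rev (map r [0..<n])))"
      unfolding set_zip_history graph_after_def by auto
    then show ?thesis by (simp add: cop_position_def)
  qed
qed

section \<open>The moves of the guards and of the chaser\<close>

text \<open>For an edge \<open>ab\<close> of a symmetric \<open>E\<close>, the condition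
  \<open>(a, b) \<notin> (burn E a b)\<^sup>*\<close> says that it is a bridge.\<close>

definition burn :: "'a rel \<Rightarrow> 'a \<Rightarrow> 'a \<Rightarrow> 'a rel" where
  "burn E a b = E - {(a, b), (b, a)}"

lemma burn_burn_commute: "burn (burn E a b) c d = burn (burn E c d) a b"
  by (auto simp: burn_def)

lemma sym_burn: "sym E \<Longrightarrow> sym (burn E a b)"
  by (auto simp: burn_def sym_def)

lemma rtrancl_burn_mono: "(x, y) \<in> (burn E a b)\<^sup>* \<Longrightarrow> (x, y) \<in> E\<^sup>*"
  using rtrancl_mono[of "burn E a b" E] by (auto simp: burn_def)

text \<open>The detour around \<open>ab\<close>, taken in either direction, replaces every use of
  \<open>ab\<close> in a walk.\<close>

lemma rtrancl_burn_nonbridge: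
  assumes "sym E" "(a, b) \<in> (burn E a b)\<^sup>*" "(x, y) \<in> E\<^sup>*"
  shows "(x, y) \<in> (burn E a b)\<^sup>*"
proof -
  have "(b, a) \<in> (burn E a b)\<^sup>*"
    using assms sym_rtrancl[OF sym_burn[OF assms(1)]] by (metis symD)
  with assms(2) have "E \<subseteq> (burn E a b)\<^sup>*"
    by (auto simp: burn_def)
  then show ?thesis
    using assms(3) rtrancl_subset_rtrancl by blast
qed

text \<open>If \<open>S\<close> is distance-2 dominating, these are the vertices at distance exactly
  2 from \<open>S\<close>.\<close>

definition far_vertices :: "'a rel \<Rightarrow> 'a set \<Rightarrow> 'a set \<Rightarrow> 'a set" where
  "far_vertices A V S = {v \<in> V. v \<notin> S \<and> (\<forall>s\<in>S. (s, v) \<notin> A)}"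

text \<open>A neighbour \<open>x\<close> of \<open>s\<close> from which the far end of a bridge at the robber's vertex \<open>u\<close> is
  guarded.\<close>

definition bridge_post :: "'a set \<Rightarrow> 'a rel \<Rightarrow> 'a \<Rightarrow> 'a \<Rightarrow> 'a \<Rightarrow> bool" where
  "bridge_post F E u s x \<longleftrightarrow>
     (s, x) \<in> E \<and> (\<exists>v\<in>F. (u, v) \<in> E \<and> (x, v) \<in> E \<and> (u, v) \<notin> (burn E u v)\<^sup>*)"

text \<open>Capture comes first. A guard away from home moves only to capture, so a post once taken
  stays occupied until then.\<close>

definition guard_move :: "'a set \<Rightarrow> 'a \<Rightarrow> 'a rel \<Rightarrow> 'a \<Rightarrow> 'a \<Rightarrow> 'a" where
  "guard_move F s E u p =
     (if (p, u) \<in> E then u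
      else if p = s \<and> (\<exists>x. bridge_post F E u s x) then SOME x. bridge_post F E u s x
      else p)"

definition walk_dist :: "'a rel \<Rightarrow> 'a \<Rightarrow> 'a \<Rightarrow> nat" where
  "walk_dist E p u = (LEAST k. (p, u) \<in> E ^^ k)"

definition chaser_move :: "'a rel \<Rightarrow> 'a \<Rightarrow> 'a \<Rightarrow> 'a" where
  "chaser_move E u p =
     (if \<exists>q. (p, q) \<in> E \<and> walk_dist E q u < walk_dist E p u
      then SOME q. (p, q) \<in> E \<and> walk_dist E q u < walk_dist E p u else p)"

lemma guard_move_legal: "guard_move F s E u p = p \<or> (p, guard_move F s E u p) \<in> E"
proof (cases "p = s \<and> (\<exists>x. bridge_post F E u s x)")
  case True
  then have "bridge_post F E u s (SOME x. bridge_post F E u s x)"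
    by (metis someI_ex)
  then have "(s, SOME x. bridge_post F E u s x) \<in> E"
    unfolding bridge_post_def by blast
  with True show ?thesis
    by (simp add: guard_move_def)
qed (auto simp: guard_move_def)

lemma chaser_move_legal: "chaser_move E u p = p \<or> (p, chaser_move E u p) \<in> E"
proof (cases "\<exists>q. (p, q) \<in> E \<and> walk_dist E q u < walk_dist E p u")
  case True
  from someI_ex[OF this] True show ?thesis by (simp add: chaser_move_def)
qed (simp only: chaser_move_def if_False simp_thms)

text \<open>The second vertex of a shortest walk to \<open>u\<close> shows that a closer neighbour
  exists.\<close>

lemma chaser_move_closer:
  assumes "(p, u) \<in> E\<^sup>*" "p \<noteq> u"
  shows "walk_dist E (chaser_move E u p) u < walk_dist E p u"
proof -
  obtain k where "(p, u) \<in> E ^^ k"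
    using assms(1) rtrancl_power by blast
  then have "(p, u) \<in> E ^^ walk_dist E p u"
    unfolding walk_dist_def by (rule LeastI)
  moreover from this assms(2) obtain m where m: "walk_dist E p u = Suc m"
    by (cases "walk_dist E p u") auto
  ultimately obtain q where q: "(p, q) \<in> E" "(q, u) \<in> E ^^ m"
    by (metis relpow_Suc_E2)
  from q(2) have "walk_dist E q u \<le> m"
    unfolding walk_dist_def by (rule Least_le)
  with q(1) m have ex: "\<exists>q. (p, q) \<in> E \<and> walk_dist E q u < walk_dist E p u"
    by (metis less_Suc_eq_le)
  from someI_ex[OF ex] ex show ?thesis by (simp add: chaser_move_def)
qed

section \<open>A robber who is never caught\<close>

locale burning_play =
  fixes A :: "'a rel" and V :: "'a set" and r :: "nat \<Rightarrow> 'a" and E :: "nat \<Rightarrow> 'a rel"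
  assumes sym_A: "sym A" and irrefl_A: "irrefl A" and finite_A: "finite A"
    and A_subset: "A \<subseteq> V \<times> V"
    and r_0: "r 0 \<in> V"
    and E_0: "E 0 = A"
    and E_Suc: "E (Suc n) = burn (E n) (r n) (r (Suc n))"
    and robber_move: "r (Suc n) = r n \<or> (r n, r (Suc n)) \<in> E n"
begin

lemma E_subset: "E n \<subseteq> A"
  by (induction n) (auto simp: E_0 E_Suc burn_def)

lemma sym_E: "sym (E n)"
  by (induction n) (auto simp: E_0 E_Suc sym_A sym_burn)

lemma E_antimono: "m \<le> n \<Longrightarrow> E n \<subseteq> E m"
  by (rule lift_Suc_antimono_le) (auto simp: E_Suc burn_def)

lemma r_in_V: "r n \<in> V"
proof (induction n)
  case (Suc n)
  then show ?case using robber_move[of n] E_subset[of n] A_subset by auto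
qed (simp add: r_0)

lemma E_eq_if_stay: "r (Suc n) = r n \<Longrightarrow> E (Suc n) = E n"
  using E_subset[of n] irrefl_A by (auto simp: E_Suc burn_def irrefl_def)

text \<open>Each actual move deletes an arc, so none is possible once \<open>card (E n)\<close> has
  reached its minimum.\<close>

lemma robber_stops:
  obtains N where "\<And>n. n \<ge> N \<Longrightarrow> r n = r N" "\<And>n. n \<ge> N \<Longrightarrow> E n = E N"
proof -
  have fin: "finite (E n)" for n
    using E_subset finite_A finite_subset by blast
  obtain N where N: "\<And>n. card (E N) \<le> card (E n)"
    using ex_has_least_nat[of "\<lambda>_. True" 0 "\<lambda>n. card (E n)"] by auto
  have stay: "r (Suc n) = r n" if "n \<ge> N" for n
  proof (rule ccontr)
    assume "r (Suc n) \<noteq> r n"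
    with robber_move have "(r n, r (Suc n)) \<in> E n - E (Suc n)"
      by (auto simp: E_Suc burn_def)
    then have "E (Suc n) \<subset> E n"
      using E_antimono[of n "Suc n"] by auto
    then have "card (E (Suc n)) < card (E n)"
      using fin psubset_card_mono by blast
    moreover have "card (E n) \<le> card (E N)"
      using E_antimono[OF that] fin card_mono by blast
    ultimately show False using N[of "Suc n"] by simp
  qed
  have "r n = r N \<and> E n = E N" if "n \<ge> N" for n
    using that by (induction n rule: dec_induct) (auto simp: stay E_eq_if_stay)
  then show thesis by (intro that) blast+
qed

text \<open>Once the robber stands still for good the graph is fixed, and the chaser's distance to
  him would decrease forever.\<close>

lemma chaser_catches:
  assumes conn: "\<And>n x y. x \<in> V \<Longrightarrow> y \<in> V \<Longrightarrow> (x, y) \<in> (E n)\<^sup>*"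
    and "c 0 \<in> V" and c_Suc: "\<And>n. c (Suc n) = chaser_move (E n) (r n) (c n)"
  shows "\<exists>n. c n = r n"
proof (rule ccontr)
  assume free: "\<nexists>n. c n = r n"
  have c_V: "c n \<in> V" for n
  proof (induction n)
    case (Suc n)
    then show ?case
      using chaser_move_legal[of "E n" "r n" "c n"] E_subset[of n] A_subset c_Suc[of n] by auto
  qed (fact assms(2))
  obtain N where N: "\<And>n. n \<ge> N \<Longrightarrow> r n = r N" "\<And>n. n \<ge> N \<Longrightarrow> E n = E N"
    using robber_stops by blast
  define d where "d k = walk_dist (E N) (c (N + k)) (r N)" for k
  have "d (Suc k) < d k" for k
  proof -
    have "c (N + k) \<noteq> r (N + k)" using free by blast
    from chaser_move_closer[OF conn[OF c_V r_in_V] this, of "N + k"] c_Suc[of "N + k"]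
    show ?thesis by (simp add: d_def N[of "N + k"])
  qed
  then show False
    by (meson wf_iff_no_infinite_down_chain[THEN iffD1, OF wf_less] mem_Collect_eq case_prodI)
qed

end

section \<open>Guards that confine the robber\<close>

locale guarded_play = burning_play A V r E for A V r E +
  fixes S :: "'a set" and g :: "'a \<Rightarrow> nat \<Rightarrow> 'a"
  assumes S_subset: "S \<subseteq> V"
    and dominating:
      "v \<in> V \<Longrightarrow> v \<in> S \<or> (\<exists>s\<in>S. (s, v) \<in> A) \<or> (\<exists>s\<in>S. \<exists>x. (s, x) \<in> A \<and> (x, v) \<in> A)"
    and conn_A: "x \<in> V \<Longrightarrow> y \<in> V \<Longrightarrow> (x, y) \<in> A\<^sup>*"
    and g_0: "g s 0 = s"
    and g_Suc: "g s (Suc n) = guard_move (far_vertices A V S) s (E n) (r n) (g s n)"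
    and free: "s \<in> S \<Longrightarrow> g s n \<noteq> r n"
    and free_Suc: "s \<in> S \<Longrightarrow> g s (Suc n) \<noteq> r n"
begin

abbreviation F :: "'a set" where
  "F \<equiv> far_vertices A V S"

text \<open>Otherwise the guard would capture with his next move, contrary to
  \<open>free_Suc\<close>.\<close>

lemma not_adjacent: "s \<in> S \<Longrightarrow> (g s n, r n) \<notin> E n"
  using free_Suc[of s n] g_Suc[of s n] by (auto simp: guard_move_def)

lemma F_D: "v \<in> F \<Longrightarrow> v \<in> V \<and> v \<notin> S"
  by (auto simp: far_vertices_def)

lemma F_not_adjacent: "v \<in> F \<Longrightarrow> s \<in> S \<Longrightarrow> (s, v) \<notin> A"
  by (auto simp: far_vertices_def)

lemma neighbour_not_F: "s \<in> S \<Longrightarrow> (s, x) \<in> A \<Longrightarrow> x \<notin> F"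
  using F_not_adjacent by blast

text \<open>A guard that left his vertex \<open>s\<close> for \<open>p\<close> watches the end \<open>b\<close> of an edge \<open>ab\<close> that the robber
  would have to cross in order to reach the vertices around \<open>s\<close>.\<close>

definition gated :: "nat \<Rightarrow> 'a \<Rightarrow> 'a \<Rightarrow> bool" where
  "gated n s p \<longleftrightarrow> (s, p) \<in> A \<and>
     (\<exists>a\<in>F. \<exists>b\<in>F. (p, b) \<in> A \<and> (s, r n) \<notin> (burn (E n) a b)\<^sup>*)"

text \<open>The invariant for the induction over rounds; its last part is what the chaser
  needs.\<close>

definition controlled :: "nat \<Rightarrow> bool" where
  "controlled n \<longleftrightarrow> (\<forall>m\<le>n. r m \<in> F) \<and> (\<forall>s\<in>S. g s n = s \<or> gated n s (g s n)) \<and>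
     (\<forall>x\<in>V. \<forall>y\<in>V. (x, y) \<in> (E n)\<^sup>*)"

text \<open>Only edges between visited vertices burn, and these vertices all lie in
  \<open>F\<close>.\<close>

lemma unburned:
  assumes "\<forall>m\<le>n. r m \<in> F" "(p, q) \<in> A" "p \<notin> F \<or> q \<notin> F"
  shows "(p, q) \<in> E n"
  using assms(1)
proof (induction n)
  case 0
  then show ?case by (simp add: E_0 assms)
next
  case (Suc n)
  then have "(p, q) \<in> E n" "r n \<in> F" "r (Suc n) \<in> F" by auto
  then show ?case using assms(3) by (auto simp: E_Suc burn_def)
qed

lemma unburned_burn:
  assumes "\<forall>m\<le>n. r m \<in> F" "(p, q) \<in> A" "p \<notin> F \<or> q \<notin> F" "a \<in> F" "b \<in> F"
  shows "(p, q) \<in> burn (E n) a b"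
  using unburned[OF assms(1-3)] assms(3-5) by (auto simp: burn_def)

text \<open>Both edges of the path contain \<open>x\<close>, which lies outside \<open>F\<close>; so
  neither has burned and neither is \<open>ab\<close>.\<close>

lemma two_steps:
  assumes "\<forall>m\<le>n. r m \<in> F" "s \<in> S" "(s, x) \<in> A" "(x, v) \<in> A" "a \<in> F" "b \<in> F"
  shows "(s, v) \<in> (burn (E n) a b)\<^sup>*"
proof -
  have x: "x \<notin> F" using neighbour_not_F assms(2,3) by blast
  show ?thesis
    using unburned_burn[OF assms(1,3) _ assms(5,6)] unburned_burn[OF assms(1,4) _ assms(5,6)] x
    by (meson converse_rtrancl_into_rtrancl r_into_rtrancl)
qed

lemma r_0_far: "r 0 \<in> F"
  using r_0 free[of _ 0] not_adjacent[of _ 0] by (auto simp: far_vertices_def g_0 E_0)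

text \<open>This is the state in the middle of a round: the guard has moved, the robber is still at
  \<open>r n\<close>. A newly posted guard gets the bridge from \<open>r n\<close> to
  \<open>v\<close> as his gate: his home reaches \<open>v\<close> without it, and \<open>r n\<close>
  does not.\<close>

lemma guards_after_move:
  assumes "controlled n" "s \<in> S"
  shows "g s (Suc n) = s \<or> gated n s (g s (Suc n))"
proof -
  have far: "\<forall>m\<le>n. r m \<in> F" and g: "g s n = s \<or> gated n s (g s n)"
    using assms by (auto simp: controlled_def)
  have nadj: "(g s n, r n) \<notin> E n" using not_adjacent[OF assms(2)] .
  show ?thesis
  proof (cases "g s n = s \<and> (\<exists>x. bridge_post F (E n) (r n) s x)")
    case True
    then have "bridge_post F (E n) (r n) s (g s (Suc n))"
      using nadj someI_ex[of "bridge_post F (E n) (r n) s"] by (simp add: g_Suc guard_move_def)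
    then obtain v where v: "v \<in> F" "(s, g s (Suc n)) \<in> A" "(g s (Suc n), v) \<in> A"
      "(r n, v) \<notin> (burn (E n) (r n) v)\<^sup>*"
      using E_subset[of n] by (auto simp: bridge_post_def)
    have "(s, v) \<in> (burn (E n) (r n) v)\<^sup>*"
      using two_steps far assms(2) v by blast
    then have "(s, r n) \<notin> (burn (E n) (r n) v)\<^sup>*"
      using v(4) sym_rtrancl[OF sym_burn[OF sym_E]] by (metis rtrancl_trans symD)
    then show ?thesis using v far by (auto simp: gated_def)
  next
    case False
    then have "g s (Suc n) = g s n" using nadj by (auto simp: g_Suc guard_move_def)
    with g show ?thesis by simp
  qed
qed

text \<open>Leaving \<open>F\<close> means stepping next to some \<open>s\<close> in
  \<open>S\<close>. A guard at home there captures. If he has left, the path from \<open>s\<close>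
  through \<open>r (Suc n)\<close> to \<open>r n\<close> bypasses his gate, a contradiction.\<close>

lemma next_far:
  assumes ctrl: "controlled n"
  shows "r (Suc n) \<in> F"
proof (rule ccontr)
  assume w: "r (Suc n) \<notin> F"
  have far: "\<forall>m\<le>n. r m \<in> F" using ctrl by (auto simp: controlled_def)
  then have u: "r n \<in> F" by simp
  with w robber_move[of n] have uw: "(r n, r (Suc n)) \<in> E n" by metis
  then have wu: "(r (Suc n), r n) \<in> A"
    using E_subset sym_A by (meson subsetD symD)
  then have "r (Suc n) \<notin> S" using u F_not_adjacent by blast
  with w obtain s where s: "s \<in> S" "(s, r (Suc n)) \<in> A"
    using r_in_V[of "Suc n"] by (auto simp: far_vertices_def)
  from guards_after_move[OF ctrl s(1)] show False
  proof
    assume home: "g s (Suc n) = s"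
    have "s \<notin> F" using F_D s(1) by blast
    then have "(s, r (Suc n)) \<in> E n" "s \<noteq> r n" "s \<noteq> r (Suc n)"
      using unburned[OF far s(2)] u irrefl_A s(2) by (auto simp: irrefl_def)
    then have "(s, r (Suc n)) \<in> E (Suc n)"
      by (auto simp: E_Suc burn_def)
    with home not_adjacent[OF s(1), of "Suc n"] show False by simp
  next
    assume "gated n s (g s (Suc n))"
    then obtain a b where ab: "a \<in> F" "b \<in> F" "(s, r n) \<notin> (burn (E n) a b)\<^sup>*"
      by (auto simp: gated_def)
    then show False using two_steps[OF far s wu] by blast
  qed
qed

text \<open>Crossing the edge \<open>ab\<close> towards \<open>b\<close> means being caught, and the robber cannot cross it in the
  other direction, being separated from \<open>b\<close>.\<close>

lemma gate_not_crossed: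
  assumes ctrl: "controlled n" and s: "s \<in> S" and "r (Suc n) \<noteq> r n"
    and p: "(s, g s (Suc n)) \<in> A" "(g s (Suc n), b) \<in> A"
    and F: "a \<in> F" "b \<in> F" and sep: "(s, r n) \<notin> (burn (E n) a b)\<^sup>*"
  shows "(r n, r (Suc n)) \<in> burn (E n) a b"
proof -
  have far: "\<forall>m\<le>Suc n. r m \<in> F"
    using ctrl next_far[OF ctrl] by (auto simp: controlled_def le_Suc_eq)
  have pF: "g s (Suc n) \<notin> F" using neighbour_not_F[OF s p(1)] .
  have "(s, b) \<in> (burn (E n) a b)\<^sup>*"
    using two_steps[of n s _ b a b] far s p F by auto
  with sep have "r n \<noteq> b" by metis
  \<comment> \<open>At \<open>b\<close> the robber would stand next to the guard, because the edge
    between them has an end outside \<open>F\<close> and is unburned.\<close>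
  moreover have "r (Suc n) \<noteq> b"
    using unburned[OF far p(2)] pF not_adjacent[OF s, of "Suc n"] by auto
  ultimately show ?thesis
    using robber_move[of n] assms(3) by (auto simp: burn_def)
qed

text \<open>The old gate still serves: the robber's step does not use it, so he stays on his side,
  and further burning reconnects nothing.\<close>

lemma gated_Suc:
  assumes ctrl: "controlled n" and s: "s \<in> S" and gate: "gated n s (g s (Suc n))"
  shows "gated (Suc n) s (g s (Suc n))"
proof (cases "r (Suc n) = r n")
  case True
  then show ?thesis using gate by (simp add: gated_def E_eq_if_stay)
next
  case False
  obtain a b where p: "(s, g s (Suc n)) \<in> A" "(g s (Suc n), b) \<in> A"
    and F: "a \<in> F" "b \<in> F" and sep: "(s, r n) \<notin> (burn (E n) a b)\<^sup>*"
    using gate by (auto simp: gated_def)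
  have "(r (Suc n), r n) \<in> burn (E n) a b"
    using gate_not_crossed[OF ctrl s False p F sep] sym_burn[OF sym_E] by (meson symD)
  with sep have "(s, r (Suc n)) \<notin> (burn (E n) a b)\<^sup>*"
    by (meson rtrancl.rtrancl_into_rtrancl)
  then have "(s, r (Suc n)) \<notin> (burn (E (Suc n)) a b)\<^sup>*"
    unfolding E_Suc burn_burn_commute[of _ "r n"] using rtrancl_burn_mono by fast
  with p F show ?thesis by (auto simp: gated_def)
qed

text \<open>Take a path \<open>s - x - v\<close> from \<open>S\<close> to the far end
  \<open>v\<close> of the bridge. The guard of \<open>s\<close> cannot still be at home, since
  \<open>x\<close> is a post for him. If he is behind a gate, perhaps at another bridge, the
  robber's step avoids that gate and leads to \<open>v\<close>, which is joined to
  \<open>s\<close>.\<close>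

lemma no_bridge_crossed:
  assumes ctrl: "controlled n" and ne: "r (Suc n) \<noteq> r n"
  shows "(r n, r (Suc n)) \<in> (burn (E n) (r n) (r (Suc n)))\<^sup>*" (is "(?u, ?v) \<in> ?B\<^sup>*")
proof (rule ccontr)
  assume bridge: "(?u, ?v) \<notin> ?B\<^sup>*"
  have far': "\<forall>m\<le>Suc n. r m \<in> F"
    using ctrl next_far[OF ctrl] by (auto simp: controlled_def le_Suc_eq)
  then have far: "\<forall>m\<le>n. r m \<in> F" and uF: "?u \<in> F" and vF: "?v \<in> F" by auto
  have uv: "(?u, ?v) \<in> E n" using robber_move[of n] ne by auto
  obtain s x where s: "s \<in> S" and x: "(s, x) \<in> A" "(x, ?v) \<in> A"
    using dominating[OF r_in_V[of "Suc n"]] F_D[OF vF] F_not_adjacent[OF vF] by blast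
  have xF: "x \<notin> F" using neighbour_not_F s x(1) by blast
  from guards_after_move[OF ctrl s] show False
  proof
    assume home: "g s (Suc n) = s"
    have "bridge_post F (E n) ?u s x"
      using unburned[OF far x(1)] unburned[OF far x(2)] xF uv vF bridge
      by (auto simp: bridge_post_def)
    then have ex: "\<exists>x. bridge_post F (E n) ?u s x" ..
    have nadj: "(g s n, r n) \<notin> E n" using not_adjacent[OF s] .
    show False
    proof (cases "g s n = s")
      case True
      then have "g s (Suc n) = (SOME x. bridge_post F (E n) ?u s x)"
        using nadj ex by (simp add: g_Suc guard_move_def)
      with someI_ex[OF ex] home have "(s, s) \<in> E n"
        by (simp add: bridge_post_def)
      then show False using E_subset[of n] irrefl_A by (auto simp: irrefl_def)
    next
      case False
      then have "g s (Suc n) = g s n" using nadj by (simp add: g_Suc guard_move_def)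
      with False home show False by simp
    qed
  next
    assume "gated n s (g s (Suc n))"
    then obtain a b where p: "(s, g s (Suc n)) \<in> A" "(g s (Suc n), b) \<in> A"
      and F: "a \<in> F" "b \<in> F" and sep: "(s, r n) \<notin> (burn (E n) a b)\<^sup>*"
      by (auto simp: gated_def)
    have "(?v, ?u) \<in> burn (E n) a b"
      using gate_not_crossed[OF ctrl s ne p F sep] sym_burn[OF sym_E] by (meson symD)
    moreover have "(s, ?v) \<in> (burn (E n) a b)\<^sup>*"
      using two_steps[OF far s x F] .
    ultimately show False using sep by (meson rtrancl.rtrancl_into_rtrancl)
  qed
qed

lemma controlled: "controlled n"
proof (induction n)
  case 0
  show ?case using r_0_far conn_A by (auto simp: controlled_def g_0 E_0)
next
  case (Suc n)
  have "\<forall>m\<le>Suc n. r m \<in> F"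
    using Suc next_far[OF Suc] by (auto simp: controlled_def le_Suc_eq)
  moreover have "\<forall>s\<in>S. g s (Suc n) = s \<or> gated (Suc n) s (g s (Suc n))"
    using guards_after_move[OF Suc] gated_Suc[OF Suc] by blast
  moreover have "(x, y) \<in> (E (Suc n))\<^sup>*" if "x \<in> V" "y \<in> V" for x y
  proof (cases "r (Suc n) = r n")
    case True
    then show ?thesis using Suc that by (simp add: controlled_def E_eq_if_stay)
  next
    case False
    then show ?thesis
      using Suc that rtrancl_burn_nonbridge[OF sym_E no_bridge_crossed[OF Suc False]]
      by (simp add: controlled_def E_Suc)
  qed
  ultimately show ?case by (simp add: controlled_def)
qed

lemma stays_connected: "x \<in> V \<Longrightarrow> y \<in> V \<Longrightarrow> (x, y) \<in> (E n)\<^sup>*"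
  using controlled[of n] by (simp add: controlled_def)

end

section \<open>The upper bound\<close>

lemma graph_dist_le_2E:
  assumes "pair_graph G" "graph_dist G s v \<le> 2"
  obtains "s = v" | "(s, v) \<in> parcs G" | x where "(s, x) \<in> parcs G" "(x, v) \<in> parcs G"
proof -
  interpret pair_graph G by fact
  have cost: "awalk_cost (\<lambda>_. 1) p = real (length p)" for p :: "('a \<times> 'a) list"
    by (induction p) auto
  \<comment> \<open>The distance is an infimum over walks; a strict bound yields an actual walk, and
    an integral length below 3 is at most 2.\<close>
  have "graph_dist G s v < 3"
    using assms(2) by (rule le_less_trans) simp
  then obtain p where p: "awalk s p v" "ereal (awalk_cost (\<lambda>_. 1) p) < 3"
    unfolding graph_dist_def \<mu>_def by (auto simp: INF_less_iff)
  from p(2) have "length p < 3" by (simp add: cost)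
  then consider "p = []" | e where "p = [e]" | e f where "p = [e, f]"
    by (cases p; cases "tl p") auto
  then show thesis
  proof cases
    case 1
    with p(1) that(1) show thesis by (simp add: awalk_Nil_iff)
  next
    case 2
    with p(1) that(2) show thesis by (cases e) (auto simp: awalk_simps)
  next
    case 3
    with p(1) that(3) show thesis by (cases e, cases f) (auto simp: awalk_simps)
  qed
qed

lemma (in pair_graph) connected_rtrancl:
  assumes "Digraph_Component.connected (with_proj G)" "u \<in> pverts G" "v \<in> pverts G"
  shows "(u, v) \<in> (parcs G)\<^sup>*"
proof -
  have "u \<rightarrow>\<^sup>*\<^bsub>with_proj G\<^esub> v"
    using symmetric_connected_imp_strongly_connected[OF pair_sym_arcs] assms
    by (simp add: strongly_connected_def)
  from reachable_rtranclI[OF this] show ?thesis by simp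
qed

lemma dist2_dominating_imp_winning:
  assumes "pair_graph G" and conn: "Digraph_Component.connected (with_proj G)"
    and dom: "dist2_dominating G S"
  shows "\<exists>\<sigma>. winning_strategy G (card S + 1) \<sigma>"
proof -
  interpret pair_graph G by fact
  let ?A = "parcs G" and ?V = "pverts G"
  let ?F = "far_vertices ?A ?V S"
  have S: "S \<subseteq> ?V" using dom by (simp add: dist2_dominating_def)
  then obtain f where f: "bij_betw f {0..<card S} S"
    using ex_bij_betw_nat_finite finite_subset pair_finite_verts by blast
  obtain v0 where v0: "v0 \<in> ?V"
    using conn by (auto simp: connected_conv)
  \<comment> \<open>Cop number \<open>card S\<close> is the chaser; his start \<open>v0\<close> is
    arbitrary.\<close>
  define start where "start i = (if i < card S then f i else v0)" for i
  define mv where "mv i = (if i < card S then guard_move ?F (f i) else chaser_move)" for i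
  obtain \<sigma> where \<sigma>_0: "\<And>r i. cop_position \<sigma> r 0 i = start i"
    and \<sigma>_Suc: "\<And>r n i. cop_position \<sigma> r (Suc n) i =
      mv i (parcs (graph_after G r n)) (r n) (cop_position \<sigma> r n i)"
    using memoryless_strategy[where start = start and G = G and mv = mv] by blast
  have "winning_strategy G (card S + 1) \<sigma>"
    unfolding winning_strategy_def
  proof (intro allI impI conjI)
    fix r assume r: "legal_robber G r"
    have "start i \<in> ?V" for i
      using f S v0 by (auto simp: start_def bij_betw_def)
    then show "legal_cops G (card S + 1) \<sigma> r"
      by (simp add: legal_cops_def legal_move_def \<sigma>_0 \<sigma>_Suc mv_def
          guard_move_legal chaser_move_legal)
    show "captured (card S + 1) \<sigma> r"
    proof (rule ccontr)
      assume uncaught: "\<not> captured (card S + 1) \<sigma> r"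
      define E where "E n = parcs (graph_after G r n)" for n
      interpret burning_play ?A ?V r E
      proof
        show "sym ?A" using pair_sym_arcs by (simp add: symmetric_def)
        show "irrefl ?A" using pair_no_loops by (fastforce simp: irrefl_def)
        show "finite ?A" by (rule pair_finite_arcs)
        show "?A \<subseteq> ?V \<times> ?V" using in_arcsD1 in_arcsD2 by auto
        show "r 0 \<in> ?V" using r by (simp add: legal_robber_def)
        show "E 0 = ?A" by (simp add: E_def graph_after_def)
        show "E (Suc n) = burn (E n) (r n) (r (Suc n))" for n
          by (auto simp: E_def graph_after_def burn_def less_Suc_eq)
        show "r (Suc n) = r n \<or> (r n, r (Suc n)) \<in> E n" for n
          using r by (auto simp: legal_robber_def legal_move_def E_def)
      qed
      define idx where "idx = inv_into {0..<card S} f"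
      have idx: "idx s < card S" "f (idx s) = s" if "s \<in> S" for s
        using that f inv_into_into[of s f "{0..<card S}"] f_inv_into_f[of s f "{0..<card S}"]
        by (auto simp: idx_def bij_betw_def)
      \<comment> \<open>\<open>guarded_play\<close> asks for the recursion at every
        \<open>s\<close>, also outside \<open>S\<close> where there is no guard. Hence
        \<open>g\<close> is defined by it and matched with the play on \<open>S\<close>
        only.\<close>
      define g where "g s = rec_nat s (\<lambda>n. guard_move ?F s (E n) (r n))" for s
      have g: "g s n = cop_position \<sigma> r n (idx s)" if "s \<in> S" for s n
        using idx[OF that] by (induction n) (simp_all add: g_def \<sigma>_0 \<sigma>_Suc start_def mv_def E_def)
      interpret guarded_play ?A ?V r E S g
      proof
        show "v \<in> S \<or> (\<exists>s\<in>S. (s, v) \<in> ?A) \<or> (\<exists>s\<in>S. \<exists>x. (s, x) \<in> ?A \<and> (x, v) \<in> ?A)"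
          if v: "v \<in> ?V" for v
        proof -
          obtain s where s: "s \<in> S" "graph_dist G s v \<le> 2"
            using dom v by (auto simp: dist2_dominating_def)
          from \<open>pair_graph G\<close> s(2) show ?thesis
            by (cases rule: graph_dist_le_2E) (use s(1) in auto)
        qed
        show "(x, y) \<in> ?A\<^sup>*" if "x \<in> ?V" "y \<in> ?V" for x y
          using connected_rtrancl[OF conn that] .
        show "g s n \<noteq> r n" "g s (Suc n) \<noteq> r n" if "s \<in> S" for s n
          using uncaught idx(1)[OF that] by (auto simp: captured_def g[OF that] less_Suc_eq)
      qed (simp_all add: S g_def)
      define c where "c n = cop_position \<sigma> r n (card S)" for n
      have "\<exists>n. c n = r n"
        by (rule chaser_catches[OF stays_connected])
          (simp_all add: c_def \<sigma>_0 \<sigma>_Suc start_def mv_def v0 E_def)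
      with uncaught show False by (auto simp: captured_def c_def)
    qed
  qed
  then show ?thesis by blast
qed

theorem theorem2p4:
  fixes G :: "'a pair_pre_digraph"
  assumes "pair_graph G"
    and "Digraph_Component.connected (with_proj G)"
  shows "bridge_burning_cop_number G \<le> dist2_domination_number G + 1"
proof -
  have "\<exists>n S. dist2_dominating G S \<and> card S = n"
    using dist2_dominating_pverts[OF assms(1)] by blast
  then have "\<exists>S. dist2_dominating G S \<and> card S = dist2_domination_number G"
    unfolding dist2_domination_number_def by (rule LeastI_ex)
  then obtain S where S: "dist2_dominating G S" "card S = dist2_domination_number G" by blast
  show ?thesis
    unfolding bridge_burning_cop_number_def S(2)[symmetric]
    by (rule Least_le) (rule dist2_dominating_imp_winning[OF assms S(1)])
qed

end
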